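(* Let $n$ be a positive integer and let $\mathcal{A} \subseteq \mathcal{P}([n])$ be antipodal. Then $$|\partial \mathcal{A}| \geq \left|\partial\left(\mathcal{I}_{n,|\mathcal{A}|/2} \cup \overline{\mathcal{I}_{n,|\mathcal{A}|/2}}\right)\right|.$$
   Context: For a positive integer $n$, $[n] := \{1,2,\ldots,n\}$ and $\mathcal{P}([n])$ is its power set. $Q_n$ is the discrete cube graph: its vertex set is $\mathcal{P}([n])$, and $x,y$ are joined by an edge iff $|x \Delta y| = 1$. For $\mathcal{A} \subseteq \mathcal{P}([n])$, the edge-boundary $\partial \mathcal{A}$ is the set of edges of $Q_n$ joining a vertex in $\mathcal{A}$ to a vertex not in $\mathcal{A}$. For $x \subseteq [n]$, $\overline{x} := [n] \setminus x$, and for $\mathcal{A} \subseteq \mathcal{P}([n])$, $\overline{\mathcal{A}} := \{\overline{x} : x \in \mathcal{A}\}$. A family $\mathcal{A}$ is antipodal if $\mathcal{A} = \overline{\mathcal{A}}$ (so $|\mathcal{A}|$ is even). The binary ordering on $\mathcal{P}([n])$ is defined by $x < y$ iff $x \neq y$ and $\max(x \Delta y) \in y$. For an integer $0 \le k \leq 2^n$, $\mathcal{I}_{n,k}$ denotes the set of the $k$ smallest elements of $\mathcal{P}([n])$ in the binary ordering. *)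

theory Defs
  imports Main
begin

definition cube_vertices :: "nat \<Rightarrow> nat set set" where
  "cube_vertices n = Pow {1..n}"

text \<open>Edges are undirected, represented as two-element sets of vertices.\<close>

definition cube_edges :: "nat \<Rightarrow> nat set set set" where
  "cube_edges n =
    {{x, y} | x y. x \<in> cube_vertices n \<and> y \<in> cube_vertices n \<and> card (sym_diff x y) = 1}"

definition edge_boundary :: "nat \<Rightarrow> nat set set \<Rightarrow> nat set set set" where
  "edge_boundary n A = {e \<in> cube_edges n. \<exists>x y. e = {x, y} \<and> x \<in> A \<and> y \<notin> A}"

definition complements :: "nat \<Rightarrow> nat set set \<Rightarrow> nat set set" where
  "complements n A = (\<lambda>x. {1..n} - x) ` A"

definition antipodal :: "nat \<Rightarrow> nat set set \<Rightarrow> bool" where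
  "antipodal n A \<longleftrightarrow> A = complements n A"

text \<open>Only meaningful on finite sets, since \<^const>\<open>Max\<close> is unspecified on infinite ones.\<close>

definition binary_less :: "nat set \<Rightarrow> nat set \<Rightarrow> bool" where
  "binary_less x y \<longleftrightarrow> x \<noteq> y \<and> Max (sym_diff x y) \<in> y"

text \<open>The \<open>k\<close> smallest vertices are those with fewer than \<open>k\<close> predecessors; see
  \<open>card_initial_segment\<close> and \<open>initial_segment_less\<close> below.\<close>

definition initial_segment :: "nat \<Rightarrow> nat \<Rightarrow> nat set set" where
  "initial_segment n k =
    {x \<in> cube_vertices n. card {y \<in> cube_vertices n. binary_less y x} < k}"

lemma finite_cube_vertices: "finite (cube_vertices n)"
  by (simp add: cube_vertices_def)

lemma finite_vertex: "x \<in> cube_vertices n \<Longrightarrow> finite x"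
  by (auto simp: cube_vertices_def intro: finite_subset)

lemma binary_less_iff:
  assumes "finite x" "finite y"
  shows "binary_less x y \<longleftrightarrow> (\<exists>m. m \<in> y \<and> m \<notin> x \<and> (\<forall>i>m. i \<in> x \<longleftrightarrow> i \<in> y))"
proof
  assume l: "binary_less x y"
  let ?d = "sym_diff x y"
  have f: "finite ?d" and ne: "?d \<noteq> {}"
    using assms l by (auto simp: binary_less_def)
  have "Max ?d \<in> ?d" using f ne by (rule Max_in)
  moreover have "i \<in> x \<longleftrightarrow> i \<in> y" if "i > Max ?d" for i
    using that Max_ge[OF f, of i] by fastforce
  ultimately show "\<exists>m. m \<in> y \<and> m \<notin> x \<and> (\<forall>i>m. i \<in> x \<longleftrightarrow> i \<in> y)"
    using l unfolding binary_less_def by (intro exI[of _ "Max ?d"]) auto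
next
  assume "\<exists>m. m \<in> y \<and> m \<notin> x \<and> (\<forall>i>m. i \<in> x \<longleftrightarrow> i \<in> y)"
  then obtain m where m: "m \<in> y" "m \<notin> x" "\<forall>i>m. i \<in> x \<longleftrightarrow> i \<in> y" by blast
  have "Max (sym_diff x y) = m"
  proof (rule Max_eqI)
    show "finite (sym_diff x y)" using assms by simp
    show "m \<in> sym_diff x y" using m by blast
    show "i \<le> m" if "i \<in> sym_diff x y" for i
    proof (rule ccontr)
      assume "\<not> i \<le> m"
      then have "i \<in> x \<longleftrightarrow> i \<in> y" using m(3) by simp
      then show False using that by blast
    qed
  qed
  then show "binary_less x y" using m(1,2) by (auto simp: binary_less_def)
qed

lemma binary_less_irrefl: "\<not> binary_less x x"
  by (simp add: binary_less_def)

lemma binary_less_trans: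
  assumes "finite x" "finite y" "finite z" "binary_less x y" "binary_less y z"
  shows "binary_less x z"
proof -
  obtain m where m: "m \<in> y" "m \<notin> x" "\<forall>i>m. i \<in> x \<longleftrightarrow> i \<in> y"
    using binary_less_iff[OF assms(1,2)] assms(4) by auto
  obtain p where p: "p \<in> z" "p \<notin> y" "\<forall>i>p. i \<in> y \<longleftrightarrow> i \<in> z"
    using binary_less_iff[OF assms(2,3)] assms(5) by auto
  have "max m p \<in> z \<and> max m p \<notin> x \<and> (\<forall>i>max m p. i \<in> x \<longleftrightarrow> i \<in> z)"
  proof (cases m p rule: linorder_cases)
    case less
    then have "max m p = p" and "\<forall>i>p. i > m" by auto
    then show ?thesis using m(3) p less by metis
  next
    case equal
    then show ?thesis using m(1) p(2) by simp
  next
    case greater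
    then have "max m p = m" and "\<forall>i>m. i > p" by auto
    then show ?thesis using m p(3) greater by metis
  qed
  then show ?thesis unfolding binary_less_iff[OF assms(1,3)] by blast
qed

lemma binary_less_total:
  assumes "finite x" "finite y" "x \<noteq> y"
  shows "binary_less x y \<or> binary_less y x"
proof -
  have "Max (sym_diff x y) \<in> sym_diff x y"
    using assms by (intro Max_in) auto
  then show ?thesis using assms by (auto simp: binary_less_def Un_commute)
qed

lemma card_predecessors_less:
  assumes "x \<in> cube_vertices n" "y \<in> cube_vertices n" "binary_less x y"
  shows "card {z \<in> cube_vertices n. binary_less z x} < card {z \<in> cube_vertices n. binary_less z y}"
proof (rule psubset_card_mono)
  show "finite {z \<in> cube_vertices n. binary_less z y}"
    by (simp add: finite_cube_vertices)
  have "binary_less z y" if "z \<in> cube_vertices n" "binary_less z x" for z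
    by (rule binary_less_trans[of z x y])
      (use that assms in \<open>auto intro: finite_vertex\<close>)
  then show "{z \<in> cube_vertices n. binary_less z x} \<subset> {z \<in> cube_vertices n. binary_less z y}"
    using assms binary_less_irrefl[of x] by blast
qed

lemma card_initial_segment:
  assumes "k \<le> 2 ^ n"
  shows "card (initial_segment n k) = k"
proof -
  let ?V = "cube_vertices n"
  let ?r = "\<lambda>x. card {y \<in> ?V. binary_less y x}"
  have cV: "card ?V = 2 ^ n" by (simp add: cube_vertices_def card_Pow)
  have inj: "inj_on ?r ?V"
  proof (rule inj_onI, rule ccontr)
    fix x y assume xy: "x \<in> ?V" "y \<in> ?V" "?r x = ?r y" "x \<noteq> y"
    then have "binary_less x y \<or> binary_less y x"
      by (intro binary_less_total finite_vertex[of _ n])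
    then show False
      using card_predecessors_less[OF xy(1,2)] card_predecessors_less[OF xy(2,1)] xy(3) by auto
  qed
  have "?r x < 2 ^ n" if "x \<in> ?V" for x
    unfolding cV[symmetric] using that binary_less_irrefl[of x]
    by (intro psubset_card_mono finite_cube_vertices) blast
  then have "?r ` ?V \<subseteq> {..<2 ^ n}" by auto
  then have img: "?r ` ?V = {..<2 ^ n}"
    by (intro card_subset_eq) (simp_all add: card_image[OF inj] cV)
  have "?r ` initial_segment n k = {..<k}"
  proof
    show "?r ` initial_segment n k \<subseteq> {..<k}" by (auto simp: initial_segment_def)
    show "{..<k} \<subseteq> ?r ` initial_segment n k"
    proof
      fix i assume i: "i \<in> {..<k}"
      then have "i \<in> ?r ` ?V" using assms img by auto
      then show "i \<in> ?r ` initial_segment n k" using i by (auto simp: initial_segment_def)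
    qed
  qed
  moreover have "inj_on ?r (initial_segment n k)"
    by (rule inj_on_subset[OF inj]) (auto simp: initial_segment_def)
  then have "card (?r ` initial_segment n k) = card (initial_segment n k)"
    by (rule card_image)
  ultimately show ?thesis by simp
qed

lemma initial_segment_less:
  assumes "x \<in> initial_segment n k" "y \<in> cube_vertices n - initial_segment n k"
  shows "binary_less x y"
proof (rule ccontr)
  assume "\<not> binary_less x y"
  moreover have "x \<noteq> y" using assms by blast
  moreover have x: "x \<in> cube_vertices n" and y: "y \<in> cube_vertices n"
    using assms by (auto simp: initial_segment_def)
  ultimately have "binary_less y x"
    using binary_less_total[OF finite_vertex[OF x] finite_vertex[OF y]] by simp
  from card_predecessors_less[OF y x this] show False
    using assms by (simp add: initial_segment_def)
qed

end

theory Submission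
  imports Defs
begin

text \<open>
  Counting degrees, we have to bound the number \<open>e(A)\<close> of edges inside an antipodal family \<open>A\<close> with
  \<open>2m\<close> elements from above, by induction on the dimension; passing to the complement, \<open>A\<close> contains
  at most half of the cube. Let \<open>B\<close> consist of the members of \<open>A\<close> that avoid the coordinate \<open>i\<close> and
  let \<open>B'\<close> be its reflection in the remaining coordinates. Then there are \<open>|B \<inter> B'| = 2p\<close> edges of
  \<open>A\<close> in direction \<open>i\<close>, and \<open>e(A) = 2 e(B) + 2p \<le> e(B \<inter> B') + e(B \<union> B') + 2p\<close> by
  supermodularity. The families \<open>B \<inter> B'\<close> and \<open>B \<union> B'\<close> are antipodal, of sizes \<open>2p\<close> and \<open>2(m - p)\<close>,
  so induction applies, and superadditivity of the edge counts of initial segments gives the bound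
  unless \<open>p\<close> is small. If \<open>p\<close> is small for every \<open>i\<close>, then \<open>A\<close> has few edges in each direction, and
  adding up over the directions suffices.
\<close>

section \<open>Edge counts of initial segments\<close>

text \<open>The number of edges inside the initial segment of size \<open>k\<close>. The recursion separates the sets
  according to whether they contain the element \<open>1\<close>.\<close>

fun segment_edges :: "nat \<Rightarrow> nat" where
  "segment_edges k = (if k < 2 then 0
     else segment_edges (k div 2) + segment_edges (k - k div 2) + k div 2)"

declare segment_edges.simps [simp del]

lemma segment_edges_0 [simp]: "segment_edges 0 = 0"
  and segment_edges_1 [simp]: "segment_edges (Suc 0) = 0"
  by (simp_all add: segment_edges.simps)

lemma segment_edges_even: "segment_edges (2 * k) = 2 * segment_edges k + k"
  by (cases "k = 0") (simp_all add: segment_edges.simps[of "2 * k"])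

lemma segment_edges_odd:
  "segment_edges (Suc (2 * k)) = segment_edges k + segment_edges (Suc k) + k"
proof (cases "k = 0")
  case False
  moreover have "Suc (2 * k) - Suc (2 * k) div 2 = Suc k" "Suc (2 * k) div 2 = k" by simp_all
  ultimately show ?thesis by (subst segment_edges.simps) simp
qed simp

lemma nat_parity_cases:
  fixes n :: nat
  obtains (even) k where "n = 2 * k" | (odd) k where "n = Suc (2 * k)"
  by (cases "even n") (auto elim: evenE oddE)

text \<open>Halving \<open>a\<close> and \<open>b\<close> splits \<open>a + b\<close> into its own
  two halves, so the induction hypothesis applies to each half. The two minima add up to
  \<open>min a b\<close>, except when both numbers are odd and equal.\<close>

lemma segment_edges_superadditive:
  "segment_edges a + segment_edges b + min a b \<le> segment_edges (a + b)"
proof (induction "a + b" arbitrary: a b rule: less_induct)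
  case less
  consider "a = 0" | "b = 0" | "a = 1" "b = 1" | "a > 0" "b > 0" "a + b > 2" by linarith
  then show ?case
  proof cases
    case 3
    then show ?thesis using segment_edges_even[of 1] by (simp add: numeral_2_eq_2)
  next
    case 4
    show ?thesis
    proof (cases a rule: nat_parity_cases)
      case (even a')
      note a = this
      show ?thesis
      proof (cases b rule: nat_parity_cases)
        case (even b')
        have "segment_edges a' + segment_edges b' + min a' b' \<le> segment_edges (a' + b')"
          using 4 a even by (intro less) auto
        then show ?thesis
          using segment_edges_even[of "a' + b'"] by (simp add: a even segment_edges_even)
      next
        case (odd b')
        have "segment_edges a' + segment_edges b' + min a' b' \<le> segment_edges (a' + b')"
          "segment_edges a' + segment_edges (Suc b') + min a' (Suc b') \<le> segment_edges (a' + Suc b')"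
          using 4 a odd by (intro less; auto)+
        then show ?thesis
          using segment_edges_odd[of "a' + b'"]
          by (simp add: a odd segment_edges_even segment_edges_odd)
      qed
    next
      case (odd a')
      note a = this
      show ?thesis
      proof (cases b rule: nat_parity_cases)
        case (even b')
        have "segment_edges a' + segment_edges b' + min a' b' \<le> segment_edges (a' + b')"
          "segment_edges (Suc a') + segment_edges b' + min (Suc a') b' \<le> segment_edges (Suc a' + b')"
          using 4 a even by (intro less; auto)+
        then show ?thesis
          using segment_edges_odd[of "a' + b'"]
          by (simp add: a even segment_edges_even segment_edges_odd)
      next
        case (odd b')
        \<comment> \<open>Lower halves are paired with upper halves, so that both sums are
          \<open>a' + b' + 1\<close>. If \<open>a' = b'\<close>, the minima fall one short of
          \<open>min a b\<close>; the extra 1 in \<open>(a + b) div 2 = a' + b' + 1\<close> makes up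
          for it.\<close>
        have "segment_edges a' + segment_edges (Suc b') + min a' (Suc b') \<le> segment_edges (a' + Suc b')"
          "segment_edges (Suc a') + segment_edges b' + min (Suc a') b' \<le> segment_edges (Suc a' + b')"
          using 4 a odd by (intro less; auto)+
        then show ?thesis
          using segment_edges_even[of "Suc (a' + b')"]
          by (simp add: a odd segment_edges_odd)
      qed
    qed
  qed auto
qed

lemma segment_edges_ge: "k \<le> Suc (segment_edges k)"
proof (induction k)
  case (Suc k)
  then show ?case using segment_edges_superadditive[of k 1] by (cases k) auto
qed simp

lemma segment_edges_power: "2 * segment_edges (2 ^ j) = j * 2 ^ j"
  by (induction j) (simp_all add: segment_edges_even algebra_simps)

text \<open>An equality case of superadditivity: the segment is a subcube of dimension
  \<open>j\<close> together with \<open>t\<close> vertices of a parallel subcube, each joined to one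
  vertex of the first.\<close>

lemma segment_edges_power_add:
  "t \<le> 2 ^ j \<Longrightarrow> segment_edges (2 ^ j + t) = segment_edges (2 ^ j) + segment_edges t + t"
proof (induction j arbitrary: t)
  case 0
  then have "t = 0 \<or> t = 1" by auto
  then show ?case using segment_edges_even[of 1] by (auto simp: numeral_2_eq_2)
next
  case (Suc j)
  show ?case
  proof (cases t rule: nat_parity_cases)
    case (even s)
    then show ?thesis
      using Suc.IH[of s] Suc.prems segment_edges_even[of "2 ^ j + s"]
      by (simp add: segment_edges_even)
  next
    case (odd s)
    \<comment> \<open>The odd number \<open>t\<close> cannot equal \<open>2 ^ Suc j\<close>, which
      leaves room for the upper half.\<close>
    then have "Suc s \<le> 2 ^ j" using Suc.prems by simp
    then show ?thesis
      using Suc.IH[of s] Suc.IH[of "Suc s"] segment_edges_odd[of "2 ^ j + s"] odd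
      by (simp add: segment_edges_even segment_edges_odd)
  qed
qed

text \<open>The rest of the cube is a reflected initial segment and has the same boundary, so
  \<open>j * a - 2 * segment_edges a\<close> is the same for \<open>a\<close> and \<open>b\<close>.
  The additive form avoids truncated subtraction.\<close>

lemma segment_edges_complement:
  "a + b = 2 ^ j \<Longrightarrow> 2 * segment_edges a + j * b = 2 * segment_edges b + j * a"
proof (induction j arbitrary: a b)
  case 0
  then have "(a = 0 \<and> b = 1) \<or> (a = 1 \<and> b = 0)" by auto
  then show ?case by auto
next
  case (Suc j)
  show ?case
  proof (cases a rule: nat_parity_cases)
    case (even a')
    then have "b = 2 * (2 ^ j - a')" "a' \<le> 2 ^ j" using Suc.prems by auto
    then obtain b' where b: "b = 2 * b'" and ab: "a' + b' = 2 ^ j" by simp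
    show ?thesis using Suc.IH[OF ab] unfolding even b segment_edges_even by (simp add: algebra_simps)
  next
    case (odd a')
    have "odd b" using Suc.prems odd by (metis even_Suc even_add even_mult_iff even_power
        dvd_refl zero_less_Suc)
    then obtain b' where b: "b = Suc (2 * b')" by (auto elim: oddE)
    then have "Suc (a' + b') = 2 ^ j" using Suc.prems odd by simp
    then have ab: "a' + Suc b' = 2 ^ j" "Suc a' + b' = 2 ^ j" by simp_all
    show ?thesis using Suc.IH[OF ab(1)] Suc.IH[OF ab(2)]
      unfolding odd b segment_edges_odd by (simp add: algebra_simps)
  qed
qed

section \<open>Counting inner edges by direction\<close>

definition flip :: "'a \<Rightarrow> 'a set \<Rightarrow> 'a set" where
  "flip i x = (if i \<in> x then x - {i} else insert i x)"

lemma flip_flip [simp]: "flip i (flip i x) = x"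
  by (auto simp: flip_def)

lemma flip_subset: "i \<in> S \<Longrightarrow> flip i x \<subseteq> S \<longleftrightarrow> x \<subseteq> S"
  by (auto simp: flip_def)

lemma inj_flip: "inj (flip i)"
  by (metis flip_flip injI)

text \<open>Every edge inside \<open>A\<close> is counted twice, once from each end.\<close>

definition inner_degree_sum :: "'a set \<Rightarrow> 'a set set \<Rightarrow> nat" where
  "inner_degree_sum S A = (\<Sum>i\<in>S. card {x \<in> A. flip i x \<in> A})"

lemma inner_degree_sum_le:
  assumes "finite A"
  shows "inner_degree_sum S A \<le> card S * card A"
proof -
  have "card {x \<in> A. flip i x \<in> A} \<le> card A" for i
    using assms by (intro card_mono) auto
  then show ?thesis
    unfolding inner_degree_sum_def using sum_bounded_above[of S _ "card A"] by simp
qed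

lemma inner_degree_sum_Pow: "finite S \<Longrightarrow> inner_degree_sum S (Pow S) = card S * 2 ^ card S"
proof -
  assume "finite S"
  have "{x \<in> Pow S. flip i x \<in> Pow S} = Pow S" if "i \<in> S" for i
    using that by (auto simp: flip_subset)
  then show ?thesis
    using \<open>finite S\<close> by (simp add: inner_degree_sum_def card_Pow)
qed

text \<open>A family and its complement have the same boundary in a regular graph. For each
  direction this is inclusion-exclusion for \<open>A\<close> and its image under the flip.\<close>

lemma inner_degree_sum_complement:
  assumes "finite S" "A \<subseteq> Pow S"
  shows "inner_degree_sum S (Pow S - A) + 2 * card S * card A
    = inner_degree_sum S A + card S * 2 ^ card S"
proof -
  have fin: "finite (Pow S)" "finite A" using assms by (auto intro: finite_subset)
  have "card {x \<in> Pow S - A. flip i x \<in> Pow S - A} + 2 * card A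
      = card {x \<in> A. flip i x \<in> A} + 2 ^ card S" if i: "i \<in> S" for i
  proof -
    let ?F = "flip i ` A"
    have F: "?F \<subseteq> Pow S" using assms(2) i by (auto simp: flip_subset image_subset_iff)
    have F': "finite ?F" "card ?F = card A"
      using fin(2) card_image[OF inj_on_subset[OF inj_flip subset_UNIV]] by auto
    have eq: "x \<in> ?F \<longleftrightarrow> flip i x \<in> A" for x
      by (metis flip_flip image_iff)
    have "{x \<in> Pow S - A. flip i x \<in> Pow S - A} = Pow S - (A \<union> ?F)"
      using i by (auto simp: flip_subset eq)
    moreover have "card (Pow S - (A \<union> ?F)) + card (A \<union> ?F) = 2 ^ card S"
      using fin F F' assms card_Diff_subset[of "A \<union> ?F" "Pow S"] card_mono[of "Pow S" "A \<union> ?F"]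
      by (simp add: card_Pow)
    moreover have "card (A \<union> ?F) + card (A \<inter> ?F) = 2 * card A"
      using card_Un_Int[OF fin(2) F'(1)] F'(2) by simp
    moreover have "A \<inter> ?F = {x \<in> A. flip i x \<in> A}" by (auto simp: eq)
    ultimately show ?thesis by simp
  qed
  then have "(\<Sum>i\<in>S. card {x \<in> Pow S - A. flip i x \<in> Pow S - A} + 2 * card A)
      = (\<Sum>i\<in>S. card {x \<in> A. flip i x \<in> A} + 2 ^ card S)"
    by (intro sum.cong) auto
  then show ?thesis
    by (simp add: inner_degree_sum_def sum.distrib algebra_simps)
qed

lemma card_split_coordinate:
  assumes "finite A"
  shows "card A = card {x \<in> A. i \<notin> x} + card {x. i \<notin> x \<and> insert i x \<in> A}"
proof -
  have eq: "A = {x \<in> A. i \<notin> x} \<union> insert i ` {x. i \<notin> x \<and> insert i x \<in> A}" (is "_ = ?L \<union> _ ` ?U")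
  proof (intro equalityI subsetI)
    fix x assume "x \<in> A"
    then have "x \<in> ?L \<or> (x = insert i (x - {i}) \<and> x - {i} \<in> ?U)" by (auto simp: insert_absorb)
    then show "x \<in> ?L \<union> insert i ` ?U" by blast
  qed auto
  have inj: "inj_on (insert i) ?U" by (auto simp: inj_on_def)
  have "finite (insert i ` ?U)" by (rule finite_subset[OF _ assms]) auto
  then have "card (?L \<union> insert i ` ?U) = card ?L + card (insert i ` ?U)"
    using assms by (intro card_Un_disjoint) auto
  then show ?thesis using eq card_image[OF inj] by simp
qed

text \<open>Edges in a direction other than \<open>i\<close> stay within one half of the cube. An
  edge in direction \<open>i\<close> is a set lying in both projected halves, counted from both
  ends.\<close>

lemma inner_degree_sum_split:
  assumes "finite T" "i \<notin> T" "finite A"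
  shows "inner_degree_sum (insert i T) A
    = inner_degree_sum T {x \<in> A. i \<notin> x} + inner_degree_sum T {x. i \<notin> x \<and> insert i x \<in> A}
      + 2 * card {x \<in> A. i \<notin> x \<and> insert i x \<in> A}"
proof -
  let ?L = "{x \<in> A. i \<notin> x}" and ?U = "{x. i \<notin> x \<and> insert i x \<in> A}"
  have "card {x \<in> A. flip j x \<in> A} = card {x \<in> ?L. flip j x \<in> ?L} + card {x \<in> ?U. flip j x \<in> ?U}"
    if "j \<in> T" for j
  proof -
    have ne: "j \<noteq> i" using that assms by auto
    have m: "i \<in> flip j x \<longleftrightarrow> i \<in> x" "flip j (insert i x) = insert i (flip j x)" for x
      using ne by (auto simp: flip_def)
    have "{x \<in> {x \<in> A. flip j x \<in> A}. i \<notin> x} = {x \<in> ?L. flip j x \<in> ?L}"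
      "{x. i \<notin> x \<and> insert i x \<in> {x \<in> A. flip j x \<in> A}} = {x \<in> ?U. flip j x \<in> ?U}"
      by (auto simp: m)
    then show ?thesis
      using card_split_coordinate[of "{x \<in> A. flip j x \<in> A}" i] assms(3) by simp
  qed
  moreover have "card {x \<in> A. flip i x \<in> A} = 2 * card {x \<in> A. i \<notin> x \<and> insert i x \<in> A}"
  proof -
    have "{x \<in> {x \<in> A. flip i x \<in> A}. i \<notin> x} = {x \<in> A. i \<notin> x \<and> insert i x \<in> A}"
      "{x. i \<notin> x \<and> insert i x \<in> {x \<in> A. flip i x \<in> A}} = {x \<in> A. i \<notin> x \<and> insert i x \<in> A}"
      by (auto simp: flip_def)
    then show ?thesis
      using card_split_coordinate[of "{x \<in> A. flip i x \<in> A}" i] assms(3) by simp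
  qed
  ultimately show ?thesis
    using assms by (simp add: inner_degree_sum_def sum.distrib)
qed

text \<open>A pair \<open>x\<close>, \<open>flip i x\<close> inside both families lies in the
  intersection; a pair inside at least one of them lies in the union.\<close>

lemma inner_degree_sum_supermodular:
  assumes "finite A" "finite B"
  shows "inner_degree_sum S A + inner_degree_sum S B
    \<le> inner_degree_sum S (A \<inter> B) + inner_degree_sum S (A \<union> B)"
proof -
  have "card {x \<in> A. flip i x \<in> A} + card {x \<in> B. flip i x \<in> B}
    \<le> card {x \<in> A \<inter> B. flip i x \<in> A \<inter> B} + card {x \<in> A \<union> B. flip i x \<in> A \<union> B}" for i
  proof -
    let ?a = "{x \<in> A. flip i x \<in> A}" and ?b = "{x \<in> B. flip i x \<in> B}"
    have "card ?a + card ?b = card (?a \<union> ?b) + card (?a \<inter> ?b)"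
      using assms by (intro card_Un_Int) auto
    moreover have "card (?a \<union> ?b) \<le> card {x \<in> A \<union> B. flip i x \<in> A \<union> B}"
      using assms by (intro card_mono) auto
    moreover have "?a \<inter> ?b = {x \<in> A \<inter> B. flip i x \<in> A \<inter> B}" by auto
    ultimately show ?thesis by simp
  qed
  then show ?thesis
    unfolding inner_degree_sum_def sum.distrib[symmetric] by (intro sum_mono)
qed

section \<open>Reflection and antipodal families\<close>

lemma inj_on_Diff: "inj_on (\<lambda>x. S - x) (Pow S)"
  by (auto simp: inj_on_def)

text \<open>Complementation commutes with every flip, hence is an automorphism of the cube.\<close>

lemma inner_degree_sum_reflect:
  assumes "A \<subseteq> Pow S"
  shows "inner_degree_sum S ((\<lambda>x. S - x) ` A) = inner_degree_sum S A"
  unfolding inner_degree_sum_def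
proof (rule sum.cong)
  fix i assume i: "i \<in> S"
  let ?c = "\<lambda>x. S - x"
  have f: "flip i (?c x) = ?c (flip i x)" if "x \<in> Pow S" for x
    using that i by (auto simp: flip_def)
  have "{x \<in> ?c ` A. flip i x \<in> ?c ` A} = ?c ` {x \<in> A. flip i x \<in> A}"
  proof -
    have "?c (flip i x) \<in> ?c ` A \<longleftrightarrow> flip i x \<in> A" if "x \<in> A" for x
      using that assms i inj_on_image_mem_iff[OF inj_on_Diff, of "flip i x" S A]
      by (auto simp: flip_subset)
    then have "flip i (?c x) \<in> ?c ` A \<longleftrightarrow> flip i x \<in> A" if "x \<in> A" for x
      using that assms f[of x] by (metis subsetD)
    then show ?thesis by blast
  qed
  moreover have "inj_on ?c {x \<in> A. flip i x \<in> A}"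
    using assms by (intro inj_on_subset[OF inj_on_Diff]) auto
  ultimately show "card {x \<in> ?c ` A. flip i x \<in> ?c ` A} = card {x \<in> A. flip i x \<in> A}"
    by (simp add: card_image)
qed simp

text \<open>By antipodality the upper half of \<open>A\<close>, projected to \<open>T\<close>, is
  the reflection of the lower half \<open>B\<close>. So \<open>B\<close> determines
  \<open>A\<close>, and both halves contribute equally.\<close>

lemma antipodal_split:
  assumes "finite T" "i \<notin> T" "A \<subseteq> Pow (insert i T)" "(\<lambda>x. insert i T - x) ` A = A"
  defines "B \<equiv> {x \<in> A. i \<notin> x}"
  shows "card A = 2 * card B"
    and "card {x \<in> A. flip i x \<in> A} = 2 * card (B \<inter> (\<lambda>x. T - x) ` B)"
    and "inner_degree_sum (insert i T) A
      = 2 * inner_degree_sum T B + 2 * card (B \<inter> (\<lambda>x. T - x) ` B)"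
proof -
  let ?c = "\<lambda>x. T - x"
  have fin: "finite A" using assms(1,3) by (meson finite_Pow_iff finite_insert finite_subset)
  have BT: "B \<subseteq> Pow T" using assms(3) by (auto simp: B_def)
  have U: "{x. i \<notin> x \<and> insert i x \<in> A} = ?c ` B"
  proof (intro set_eqI iffI)
    fix x assume x: "x \<in> {x. i \<notin> x \<and> insert i x \<in> A}"
    then have "insert i T - insert i x \<in> A" using assms(4) by blast
    moreover have "insert i T - insert i x = T - x" using assms(2) by auto
    moreover have "T - (T - x) = x" using x assms(3) by auto
    ultimately have "T - x \<in> B" "x = T - (T - x)" using assms(2) by (auto simp: B_def)
    then show "x \<in> ?c ` B" by blast
  next
    fix x assume "x \<in> ?c ` B"
    then obtain y where y: "y \<in> A" "i \<notin> y" "x = T - y" by (auto simp: B_def)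
    then have "insert i T - y \<in> A" using assms(4) by blast
    moreover have "insert i T - y = insert i x" using y by auto
    ultimately show "x \<in> {x. i \<notin> x \<and> insert i x \<in> A}" using y assms(2) by auto
  qed
  have X: "{x \<in> A. i \<notin> x \<and> insert i x \<in> A} = B \<inter> ?c ` B"
    using U by (auto simp: B_def)
  have "card (?c ` B) = card B"
    using BT by (intro card_image inj_on_subset[OF inj_on_Diff])
  then show "card A = 2 * card B"
    using card_split_coordinate[OF fin, of i] U by (simp add: B_def)
  show "inner_degree_sum (insert i T) A
      = 2 * inner_degree_sum T B + 2 * card (B \<inter> ?c ` B)"
    using inner_degree_sum_split[OF assms(1,2) fin] U X inner_degree_sum_reflect[OF BT]
    by (simp add: B_def)
  have "{x \<in> {x \<in> A. flip i x \<in> A}. i \<notin> x} = B \<inter> ?c ` B"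
    "{x. i \<notin> x \<and> insert i x \<in> {x \<in> A. flip i x \<in> A}} = B \<inter> ?c ` B"
    unfolding X[symmetric] by (auto simp: flip_def)
  then show "card {x \<in> A. flip i x \<in> A} = 2 * card (B \<inter> ?c ` B)"
    using card_split_coordinate[of "{x \<in> A. flip i x \<in> A}" i] fin by simp
qed

lemma even_card_antipodal:
  assumes "finite S" "S \<noteq> {}" "A \<subseteq> Pow S" "(\<lambda>x. S - x) ` A = A"
  shows "even (card A)"
proof -
  obtain i where "i \<in> S" using assms(2) by blast
  then have "insert i (S - {i}) = S" by auto
  then show ?thesis
    using antipodal_split(1)[of "S - {i}" i A] assms by simp
qed

section \<open>The upper bound for antipodal families\<close>

text \<open>The induction step for families filling at most half of the cube, where the truncated
  excess term of the bound vanishes in the conclusion but may survive for the union used inside the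
  proof.\<close>

lemma inner_degree_sum_antipodal_step:
  fixes S :: "'a set"
  assumes IH: "\<And>(T :: 'a set) A m. \<lbrakk>finite T; card T = M; A \<subseteq> Pow T; (\<lambda>x. T - x) ` A = A; card A = 2 * m\<rbrakk>
      \<Longrightarrow> inner_degree_sum T A \<le> 4 * segment_edges m + 2 * (2 * m - 2 ^ (M - 1))"
    and M: "M \<ge> 1" and S: "finite S" "card S = Suc M"
    and A: "A \<subseteq> Pow S" "(\<lambda>x. S - x) ` A = A" "card A = 2 * m" and m: "m \<le> 2 ^ (M - 1)"
  shows "inner_degree_sum S A \<le> 4 * segment_edges m"
proof -
  let ?R = "2 ^ (M - 1) :: nat"
  let ?d = "\<lambda>i. card {x \<in> A. flip i x \<in> A}"
  have direction: "\<exists>p. ?d i = 4 * p \<and> 2 * p \<le> m \<and>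
      inner_degree_sum S A \<le> 4 * p + 4 * segment_edges p + 4 * segment_edges (m - p)
        + 2 * (2 * (m - p) - ?R)" if i: "i \<in> S" for i
  proof -
    define T where "T = S - {i}"
    define B where "B = {x \<in> A. i \<notin> x}"
    let ?c = "\<lambda>x. T - x"
    have ST: "S = insert i T" "i \<notin> T" "finite T" "card T = M"
      using i S by (auto simp: T_def)
    then have neT: "T \<noteq> {}" using M by auto
    note split = antipodal_split[OF ST(3,2) A(1,2)[unfolded ST(1)], folded B_def]
    have BT: "B \<subseteq> Pow T" using A(1) by (auto simp: B_def T_def)
    have finB: "finite B" using BT ST(3) by (meson finite_Pow_iff finite_subset)
    have cc: "?c ` ?c ` B = B" using BT by (force simp: image_image double_diff)
    let ?I = "B \<inter> ?c ` B" and ?U = "B \<union> ?c ` B"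
    have IT: "?I \<subseteq> Pow T" "?U \<subseteq> Pow T" using BT by auto
    have "?c ` ?I = ?c ` B \<inter> ?c ` ?c ` B"
      using BT by (intro inj_on_image_Int[OF inj_on_Diff]) auto
    then have cI: "?c ` ?I = ?I" using cc by auto
    have cU: "?c ` ?U = ?U" using cc by (auto simp: image_Un)
    obtain p where p: "card ?I = 2 * p"
      using even_card_antipodal[OF ST(3) neT IT(1) cI] by (auto elim: evenE)
    have cB: "card B = m" using split(1) A(3) by simp
    have ccB: "card (?c ` B) = m"
      using cB card_image[OF inj_on_subset[OF inj_on_Diff BT]] by simp
    have U: "card ?U + 2 * p = 2 * m"
      using card_Un_Int[of B "?c ` B"] finB cB ccB p by simp
    have pm: "2 * p \<le> m" using card_mono[of B ?I] finB cB p by simp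
    have "2 * inner_degree_sum T B \<le> inner_degree_sum T ?I + inner_degree_sum T ?U"
      using inner_degree_sum_supermodular[of B "?c ` B" T] finB inner_degree_sum_reflect[OF BT]
      by simp
    \<comment> \<open>The excess term is 0 here, since
      \<open>2 * p \<le> m \<le> ?R\<close>.\<close>
    moreover have "inner_degree_sum T ?I \<le> 4 * segment_edges p"
      using IH[OF ST(3,4) IT(1) cI p] pm m by simp
    moreover have "inner_degree_sum T ?U \<le> 4 * segment_edges (m - p) + 2 * (2 * (m - p) - ?R)"
      using IH[OF ST(3,4) IT(2) cU, of "m - p"] U by simp
    ultimately show ?thesis
      using split(2,3) p pm ST(1) by (intro exI[of _ p]) simp
  qed
  have super: "segment_edges p + segment_edges (m - p) + p \<le> segment_edges m" if "2 * p \<le> m" for p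
    using segment_edges_superadditive[of p "m - p"] that by (simp add: min_def split: if_splits)
  show ?thesis
  \<comment> \<open>If so, the excess term of the union is 0 for every \<open>p\<close>, and any
    direction together with superadditivity suffices.\<close>
  proof (cases "2 * m \<le> ?R")
    case True
    obtain i where "i \<in> S" using S by fastforce
    then obtain p where "2 * p \<le> m"
      "inner_degree_sum S A \<le> 4 * p + 4 * segment_edges p + 4 * segment_edges (m - p)
        + 2 * (2 * (m - p) - ?R)"
      using direction by blast
    then show ?thesis using super[of p] True by simp
  next
    case False
    show ?thesis
    \<comment> \<open>This case is separate because \<open>2 ^ (M - 2)\<close> below needs
      \<open>M \<ge> 2\<close>. Here \<open>m = 1\<close> forces \<open>p = 0\<close>, so
      \<open>A\<close> has no inner edges.\<close>
    proof (cases "M = 1")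
      case True
      then have "m = 1" using False m by simp
      then have "?d i = 0" if "i \<in> S" for i using direction[OF that] by auto
      then show ?thesis by (simp add: inner_degree_sum_def)
    next
      case M2: False
      \<comment> \<open>Now \<open>Q < m \<le> 2 * Q\<close>, so \<open>segment_edges m\<close>
        splits at the power \<open>Q\<close> with remainder \<open>s\<close>. The excess term
        becomes \<open>4 * (s - p)\<close>.\<close>
      define Q where "Q = (2 :: nat) ^ (M - 2)"
      define s where "s = m - Q"
      have R: "?R = 2 * Q"
        using M M2 by (simp add: Q_def flip: power_Suc)
      have ms: "m = Q + s" "s \<le> Q" "s \<ge> 1" using False m R by (auto simp: s_def)
      have em: "segment_edges m = segment_edges Q + segment_edges s + s"
        using segment_edges_power_add[of s "M - 2"] ms by (simp add: Q_def)
      show ?thesis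
      \<comment> \<open>With \<open>?d i = 4 * p\<close> the condition says
        \<open>s - p \<le> p\<close>. Then the smaller part in the superadditivity for
        \<open>s = p + t\<close> is \<open>t\<close>, which pays for the second \<open>t\<close>
        coming from the excess.\<close>
      proof (cases "\<exists>i\<in>S. s \<le> ?d i div 2")
        case True
        then obtain i where i: "i \<in> S" "s \<le> ?d i div 2" by blast
        obtain p where p: "?d i = 4 * p" "2 * p \<le> m"
          "inner_degree_sum S A \<le> 4 * p + 4 * segment_edges p + 4 * segment_edges (m - p)
            + 2 * (2 * (m - p) - ?R)"
          using direction[OF i(1)] by blast
        show ?thesis
        proof (cases "m - p \<le> Q")
          case True
          then show ?thesis using p super[of p] R by simp
        next
          case False
          define t where "t = m - p - Q"
          have t: "m - p = Q + t" "t + p = s" "t \<le> p" "t \<le> Q"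
            using False i(2) p ms by (auto simp: t_def)
          have "segment_edges (m - p) = segment_edges Q + segment_edges t + t"
            using segment_edges_power_add[of t "M - 2"] t by (simp add: Q_def)
          moreover have "segment_edges p + segment_edges t + t \<le> segment_edges s"
            using segment_edges_superadditive[of p t] t by (simp add: add.commute)
          ultimately show ?thesis using p(3) em R t by simp
        qed
      next
        case False
        have "?d i \<le> 2 * (s - 1)" if "i \<in> S" for i
        proof -
          obtain p where "?d i = 4 * p" using direction[OF \<open>i \<in> S\<close>] by blast
          then show ?thesis using False that by (auto simp: not_le)
        qed
        then have "inner_degree_sum S A \<le> card S * (2 * (s - 1))"
          unfolding inner_degree_sum_def using sum_bounded_above[of S ?d "2 * (s - 1)"] by simp
        \<comment> \<open>Of the \<open>N + 3\<close> directions, \<open>N\<close> are paid for by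
          \<open>4 * segment_edges Q = 2 * N * Q\<close>. The other three need
          \<open>6 * (s - 1)\<close>, which is below
          \<open>4 * segment_edges s + 4 * s\<close>.\<close>
        moreover have "card S * (2 * (s - 1)) \<le> 4 * segment_edges m"
        proof -
          obtain N where N: "M = N + 2" using M M2 by (metis add.commute le_add_diff_inverse
              One_nat_def Suc_leI le_neq_implies_less numeral_2_eq_2)
          obtain r where r: "s = Suc r" using ms by (cases s) auto
          have "2 * segment_edges Q = N * Q" using segment_edges_power[of N] N by (simp add: Q_def)
          moreover have "N * s \<le> N * Q" using ms by simp
          moreover have "s \<le> Suc (segment_edges s)" by (rule segment_edges_ge)
          ultimately show ?thesis using em S(2) by (simp add: N r algebra_simps)
        qed
        ultimately show ?thesis by simp
      qed
    qed
  qed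
qed

text \<open>The bound is what an initial segment of size \<open>m\<close> in dimension
  \<open>M\<close> yields as lower half; the truncated term is twice its least possible overlap with
  its reflection. Families filling more than half of the cube are handled through their
  complements.\<close>

lemma inner_degree_sum_antipodal:
  assumes "finite S" "card S = Suc M" "A \<subseteq> Pow S" "(\<lambda>x. S - x) ` A = A" "card A = 2 * m"
  shows "inner_degree_sum S A \<le> 4 * segment_edges m + 2 * (2 * m - 2 ^ M)"
  using assms
proof (induction M arbitrary: S A m)
  case 0
  have "card A \<le> 2" using card_mono[of "Pow S" A] 0 by (simp add: card_Pow)
  then have "m = 0 \<or> m = 1" using 0 by auto
  moreover have "inner_degree_sum S A \<le> card A"
    using inner_degree_sum_le[of A S] 0 by (metis One_nat_def finite_Pow_iff finite_subset nat_mult_1)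
  ultimately show ?case using 0 by auto
next
  case (Suc M)
  have half: "inner_degree_sum S A \<le> 4 * segment_edges m"
    if "A \<subseteq> Pow S" "(\<lambda>x. S - x) ` A = A" "card A = 2 * m" "m \<le> 2 ^ M" for A m
    by (rule inner_degree_sum_antipodal_step[where M = "Suc M"]) (use that Suc in auto)
  show ?case
  proof (cases "m \<le> 2 ^ M")
    case True
    then show ?thesis using half[OF Suc.prems(3-5)] by simp
  next
    case False
    have fin: "finite A" using Suc.prems by (meson finite_Pow_iff finite_subset)
    have "card A \<le> 2 ^ Suc (Suc M)"
      using card_mono[OF _ Suc.prems(3)] Suc.prems by (simp add: card_Pow)
    then have m: "m \<le> 2 ^ Suc M" using Suc.prems by simp
    define l where "l = 2 ^ Suc M - m"
    have l: "l + m = 2 ^ Suc M" using m by (simp add: l_def)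
    let ?A = "Pow S - A"
    have "(\<lambda>x. S - x) ` ?A = (\<lambda>x. S - x) ` Pow S - (\<lambda>x. S - x) ` A"
      using Suc.prems(3) by (intro inj_on_image_set_diff[OF inj_on_Diff]) auto
    moreover have "(\<lambda>x. S - x) ` Pow S = Pow S"
      by (auto simp: image_iff intro!: bexI[of _ "S - _"])
    ultimately have "(\<lambda>x. S - x) ` ?A = ?A" using Suc.prems by simp
    moreover have "card ?A = 2 * l"
      using card_Diff_subset[OF fin Suc.prems(3)] Suc.prems l by (simp add: card_Pow)
    ultimately have "inner_degree_sum S ?A \<le> 4 * segment_edges l"
      using False l by (intro half) auto
    moreover have "inner_degree_sum S ?A + 2 * card S * card A
        = inner_degree_sum S A + card S * 2 ^ card S"
      using Suc.prems by (intro inner_degree_sum_complement)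
    moreover have "2 * segment_edges l + Suc M * m = 2 * segment_edges m + Suc M * l"
      using segment_edges_complement[OF l] .
    moreover have "(2::nat) ^ card S = 2 * (l + m)" using l Suc.prems by simp
    \<comment> \<open>The two complement identities have coefficients \<open>Suc (Suc M)\<close> and
      \<open>Suc M\<close>; the difference of one dimension leaves exactly the excess
      \<open>2 * (m - l)\<close>.\<close>
    moreover have "2 * m - 2 ^ Suc M = m - l" "l \<le> m" using l False by auto
    ultimately show ?thesis
      using Suc.prems(2,5) by (simp add: algebra_simps)
  qed
qed

section \<open>The lower bound for initial segments\<close>

text \<open>Split at the largest coordinate: either \<open>D\<close> avoids it, or \<open>D\<close>
  contains the whole lower subcube and its upper part is again downward closed. The second case
  matches \<open>segment_edges_power_add\<close>.\<close>

lemma inner_degree_sum_downclosed: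
  assumes "D \<subseteq> Pow {1..n}"
    and "\<And>x y. x \<in> D \<Longrightarrow> y \<subseteq> {1..n} \<Longrightarrow> binary_less y x \<Longrightarrow> y \<in> D"
  shows "2 * segment_edges (card D) \<le> inner_degree_sum {1..n} D"
  using assms
proof (induction n arbitrary: D)
  case 0
  then have "card D \<le> 1" using card_mono[of "Pow {1..0}" D] by simp
  then have "card D = 0 \<or> card D = 1" by auto
  then show ?case by auto
next
  case (Suc n)
  let ?T = "{1..n}" and ?i = "Suc n"
  have S: "{1..?i} = insert ?i ?T" "?i \<notin> ?T" and TS: "?T \<subseteq> {1..?i}" by auto
  have fin: "finite D" using Suc.prems(1) by (meson finite_Pow_iff finite_atLeastAtMost finite_subset)
  let ?L = "{x \<in> D. ?i \<notin> x}" and ?U = "{x. ?i \<notin> x \<and> insert ?i x \<in> D}"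
  note split = inner_degree_sum_split[OF _ S(2) fin, folded S(1)]
  have less: "binary_less y x" if "y \<subseteq> ?T" "x \<subseteq> {1..?i}" "?i \<in> x" for x y
  proof -
    have "finite x" "finite y" using that by (auto intro: finite_subset)
    moreover have "?i \<notin> y" "\<forall>j>?i. j \<in> y \<longleftrightarrow> j \<in> x" using that by auto
    ultimately show ?thesis using that(3) by (subst binary_less_iff) blast+
  qed
  show ?case
  proof (cases "?U = {}")
    case True
    have "?i \<notin> x" if "x \<in> D" for x
      using True that insert_Diff[of ?i x] by (metis (no_types, lifting) Diff_iff empty_Collect_eq singletonI)
    then have DL: "?L = D" by blast
    then have DT: "D \<subseteq> Pow ?T" using Suc.prems(1) unfolding S(1) by blast
    have "2 * segment_edges (card D) \<le> inner_degree_sum ?T D"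
      by (rule Suc.IH[OF DT]) (use Suc.prems(2) TS in blast)
    then show ?thesis using split DL by simp
  next
    case False
    then obtain x where x: "insert ?i x \<in> D" by blast
    have PD: "y \<in> D" if "y \<subseteq> ?T" for y
    proof (rule Suc.prems(2)[OF x])
      show "y \<subseteq> {1..?i}" using that by auto
      show "binary_less y (insert ?i x)" using x Suc.prems(1) that by (intro less) auto
    qed
    have L: "?L = Pow ?T"
    proof (intro equalityI subsetI)
      fix x assume "x \<in> ?L"
      then show "x \<in> Pow ?T" using Suc.prems(1) unfolding S(1) by blast
    next
      fix x assume "x \<in> Pow ?T"
      then show "x \<in> ?L" using PD[of x] S(2) by blast
    qed
    have UT: "?U \<subseteq> Pow ?T" using Suc.prems(1) unfolding S(1) by blast
    have "2 * segment_edges (card ?U) \<le> inner_degree_sum ?T ?U"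
    proof (rule Suc.IH[OF UT])
      fix x y assume x: "x \<in> ?U" and y: "y \<subseteq> ?T" and xy: "binary_less y x"
      have fxy: "finite x" "finite y" using x UT y by (auto intro: finite_subset)
      have iy: "?i \<notin> y" using y by auto
      obtain k where k: "k \<in> x" "k \<notin> y" "\<forall>j>k. j \<in> y \<longleftrightarrow> j \<in> x"
        using xy binary_less_iff[OF fxy(2,1)] by blast
      have "binary_less (insert ?i y) (insert ?i x)"
        using fxy k x by (subst binary_less_iff) (auto intro!: exI[of _ k])
      then have "insert ?i y \<in> D"
        using x y Suc.prems(2)[of "insert ?i x" "insert ?i y"] S(1) by blast
      then show "y \<in> ?U" using iy by blast
    qed
    \<comment> \<open>The lower half is complete, so every upper vertex has its lower neighbour in
      \<open>D\<close>.\<close>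
    moreover have "{x \<in> D. ?i \<notin> x \<and> insert ?i x \<in> D} = ?U" using UT L by blast
    moreover have "inner_degree_sum ?T ?L = 2 * segment_edges (2 ^ n)"
      using inner_degree_sum_Pow[of ?T] by (simp add: L segment_edges_power)
    moreover have "card D = 2 ^ n + card ?U"
      using card_split_coordinate[OF fin, of ?i] by (simp add: L card_Pow)
    moreover have "card ?U \<le> 2 ^ n" using card_mono[OF _ UT] by (simp add: card_Pow)
    ultimately show ?thesis using split segment_edges_power_add[of "card ?U" n] by simp
  qed
qed

section \<open>From inner degrees to the edge boundary\<close>

text \<open>Each vertex of \<open>A\<close> has \<open>n\<close> flips, which either stay in
  \<open>A\<close> or leave it. A boundary edge has exactly one end in \<open>A\<close>, so it
  corresponds to one leaving pair of direction and vertex.\<close>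

lemma card_edge_boundary:
  assumes "A \<subseteq> Pow {1..n}"
  shows "card (edge_boundary n A) + inner_degree_sum {1..n} A = n * card A"
proof -
  have fin: "finite A" using assms by (meson finite_Pow_iff finite_atLeastAtMost finite_subset)
  let ?P = "SIGMA i:{1..n}. {x \<in> A. flip i x \<notin> A}"
  let ?f = "\<lambda>(i, x). {x, flip i x}"
  have sd: "card (sym_diff x y) = 1 \<longleftrightarrow> (\<exists>i. y = flip i x)" for x y :: "nat set"
  proof
    assume "card (sym_diff x y) = 1"
    then obtain i where i: "sym_diff x y = {i}" by (auto simp: card_1_singleton_iff)
    have "j \<in> y \<longleftrightarrow> (j \<in> x \<longleftrightarrow> j \<noteq> i)" for j
      using eqset_imp_iff[OF i, of j] by blast
    then have "y = flip i x" by (auto simp: flip_def)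
    then show "\<exists>i. y = flip i x" ..
  next
    assume "\<exists>i. y = flip i x"
    then obtain i where "y = flip i x" ..
    then have "sym_diff x y = {i}" by (auto simp: flip_def)
    then show "card (sym_diff x y) = 1" by simp
  qed
  have inj: "inj_on ?f ?P"
  proof (rule inj_onI, clarify)
    fix i x j y
    assume "x \<in> A" "flip i x \<notin> A" "y \<in> A" "flip j y \<notin> A" "{x, flip i x} = {y, flip j y}"
    then have "x = y" "flip i x = flip j y" by (auto simp: doubleton_eq_iff)
    moreover from this have "i = j" by (auto simp: flip_def split: if_splits)
    ultimately show "i = j \<and> x = y" by simp
  qed
  have "?f ` ?P = edge_boundary n A"
  proof (intro equalityI subsetI)
    fix e assume "e \<in> ?f ` ?P"
    then obtain i x where *: "i \<in> {1..n}" "x \<in> A" "flip i x \<notin> A" "e = {x, flip i x}" by auto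
    then have "x \<subseteq> {1..n}" "flip i x \<subseteq> {1..n}" using assms by (auto simp: flip_subset)
    then have "e \<in> cube_edges n"
      unfolding cube_edges_def cube_vertices_def using * sd[of x "flip i x"] by blast
    then show "e \<in> edge_boundary n A" unfolding edge_boundary_def using * by blast
  next
    fix e assume "e \<in> edge_boundary n A"
    then have "e \<in> cube_edges n" "\<exists>x y. e = {x, y} \<and> x \<in> A \<and> y \<notin> A"
      by (simp_all add: edge_boundary_def)
    moreover from this obtain u v where "e = {u, v}"
      "u \<subseteq> {1..n}" "v \<subseteq> {1..n}" "card (sym_diff u v) = 1"
      by (auto simp: cube_edges_def cube_vertices_def)
    ultimately obtain x y u v where *: "e = {x, y}" "x \<in> A" "y \<notin> A" "e = {u, v}"
      "u \<subseteq> {1..n}" "v \<subseteq> {1..n}" "card (sym_diff u v) = 1"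
      by metis
    then have "(u = x \<and> v = y) \<or> (u = y \<and> v = x)" by (auto simp: doubleton_eq_iff)
    then have xy: "x \<subseteq> {1..n}" "y \<subseteq> {1..n}" "card (sym_diff x y) = 1"
      using *(5-7) Un_commute[of "u - v" "v - u"] by metis+
    then obtain i where i: "y = flip i x" using sd by blast
    then have "i \<in> x \<or> i \<in> y" by (simp add: flip_def)
    then have "i \<in> {1..n}" using xy by blast
    then have "(i, x) \<in> ?P" "e = ?f (i, x)" using * i by auto
    then show "e \<in> ?f ` ?P" by (rule rev_image_eqI)
  qed
  then have "card (edge_boundary n A) = card ?P" using card_image[OF inj] by simp
  also have "\<dots> = (\<Sum>i\<in>{1..n}. card {x \<in> A. flip i x \<notin> A})"
    using fin by (intro card_SigmaI) auto
  finally have "card (edge_boundary n A) + inner_degree_sum {1..n} A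
      = (\<Sum>i\<in>{1..n}. card {x \<in> A. flip i x \<notin> A} + card {x \<in> A. flip i x \<in> A})"
    by (simp add: inner_degree_sum_def sum.distrib)
  also have "\<dots> = (\<Sum>i\<in>{1..n}. card A)"
  proof (rule sum.cong)
    fix i
    have "card ({x \<in> A. flip i x \<notin> A} \<union> {x \<in> A. flip i x \<in> A})
      = card {x \<in> A. flip i x \<notin> A} + card {x \<in> A. flip i x \<in> A}"
      using fin by (intro card_Un_disjoint) auto
    moreover have "{x \<in> A. flip i x \<notin> A} \<union> {x \<in> A. flip i x \<in> A} = A" by auto
    ultimately show "card {x \<in> A. flip i x \<notin> A} + card {x \<in> A. flip i x \<in> A} = card A" by simp
  qed simp
  finally show ?thesis by simp
qed

section \<open>Comparison with the extremal family\<close>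

lemma initial_segment_downclosed:
  assumes "x \<in> initial_segment n k" "y \<subseteq> {1..n}" "binary_less y x"
  shows "y \<in> initial_segment n k"
proof (rule ccontr)
  assume "y \<notin> initial_segment n k"
  then have "binary_less x y"
    using assms by (intro initial_segment_less) (auto simp: cube_vertices_def)
  moreover have "finite x" "finite y"
    using assms by (auto simp: initial_segment_def cube_vertices_def intro: finite_subset)
  ultimately show False
    using binary_less_trans[of x y x] assms(3) binary_less_irrefl by blast
qed

text \<open>A member containing \<open>Suc n\<close> would lie above all \<open>2 ^ n\<close>
  subsets of \<open>{1..n}\<close>, which together with it are more than \<open>k\<close>
  sets.\<close>

lemma initial_segment_subset:
  assumes "k \<le> 2 ^ n"
  shows "initial_segment (Suc n) k \<subseteq> Pow {1..n}"
proof (rule ccontr)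
  let ?I = "initial_segment (Suc n) k"
  assume "\<not> ?I \<subseteq> Pow {1..n}"
  then obtain x where x: "x \<in> ?I" "\<not> x \<subseteq> {1..n}" by blast
  have xS: "x \<subseteq> {1..Suc n}" using x(1) by (auto simp: initial_segment_def cube_vertices_def)
  then have sx: "Suc n \<in> x" using x(2) using xS le_Suc_eq by (auto simp: subset_iff)
  have finI: "finite ?I" by (simp add: initial_segment_def finite_cube_vertices)
  have "y \<in> ?I" if "y \<subseteq> {1..n}" for y
  proof (rule initial_segment_downclosed[OF x(1)])
    show "y \<subseteq> {1..Suc n}" using that by auto
    have "finite x" "finite y" using that xS by (auto intro: finite_subset)
    moreover have "Suc n \<notin> y" "\<forall>j>Suc n. j \<in> y \<longleftrightarrow> j \<in> x" using that xS by auto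
    ultimately show "binary_less y x" using sx by (subst binary_less_iff) blast+
  qed
  then have "insert x (Pow {1..n}) \<subseteq> ?I" using x by auto
  then have "card (insert x (Pow {1..n})) \<le> card ?I" using finI by (intro card_mono)
  moreover have "card ?I = k" using assms by (intro card_initial_segment) simp
  ultimately show False using x(2) assms by (simp add: card_Pow)
qed

text \<open>Both families have the same size, so by \<open>card_edge_boundary\<close> it suffices to
  show that the extremal one has at least as large an inner degree sum.\<close>

theorem theorem2:
  fixes n :: nat and A :: "nat set set"
  assumes "n \<ge> 1"
    and "A \<subseteq> Pow {1..n}"
    and "antipodal n A"
  shows "card (edge_boundary n A) \<ge>
    card (edge_boundary n
      (initial_segment n (card A div 2) \<union> complements n (initial_segment n (card A div 2))))"
proof -
  obtain M where n: "n = Suc M" using assms(1) by (cases n) auto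
  define k where "k = card A div 2"
  define I where "I = initial_segment n k"
  let ?S = "{1..n}" and ?T = "{1..M}"
  let ?X = "I \<union> complements n I"
  have anti: "(\<lambda>x. ?S - x) ` A = A" using assms(3) by (simp add: antipodal_def complements_def)
  have kA: "card A = 2 * k"
    using even_card_antipodal[OF _ _ assms(2) anti] assms(1) by (simp add: k_def)
  have upper: "inner_degree_sum ?S A \<le> 4 * segment_edges k + 2 * (2 * k - 2 ^ M)"
    using inner_degree_sum_antipodal[OF _ _ assms(2) anti kA, of M] n by simp
  have "card A \<le> 2 ^ n" using card_mono[OF _ assms(2)] by (simp add: card_Pow)
  then have kM: "k \<le> 2 ^ M" using kA n by simp
  have IT: "I \<subseteq> Pow ?T" using initial_segment_subset[OF kM] by (simp add: I_def n)
  have cI: "card I = k" using card_initial_segment[of k n] kM n by (simp add: I_def)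
  have finI: "finite I" using IT by (meson finite_Pow_iff finite_atLeastAtMost finite_subset)
  have S: "?S = insert n ?T" "n \<notin> ?T" using n by auto
  have IS: "I \<subseteq> Pow ?S" using IT unfolding S(1) by blast
  have XS: "?X \<subseteq> Pow (insert n ?T)"
    using IS unfolding S(1)[symmetric] complements_def by blast
  have "?S - (?S - x) = x" if "x \<in> I" for x using that IS by blast
  then have "(\<lambda>x. ?S - x) ` (\<lambda>x. ?S - x) ` I = I"
    by (simp add: image_image)
  then have Xanti: "(\<lambda>x. insert n ?T - x) ` ?X = ?X"
    unfolding S(1)[symmetric] complements_def image_Un by blast
  have "n \<notin> x" if "x \<in> I" for x using that IT S(2) by blast
  \<comment> \<open>The segment lives on \<open>{1..M}\<close>, so all its complements contain
    \<open>n\<close>, and the lower half of \<open>?X\<close> is \<open>I\<close> itself.\<close>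
  then have XI: "{x \<in> ?X. n \<notin> x} = I" unfolding complements_def S(1) by blast
  note split = antipodal_split[OF _ S(2) XS Xanti, unfolded XI, folded S(1)]
  have "2 * segment_edges k \<le> inner_degree_sum ?T I"
    unfolding cI[symmetric]
  proof (rule inner_degree_sum_downclosed[OF IT])
    fix x y assume *: "x \<in> I" "y \<subseteq> ?T" "binary_less y x"
    then have "y \<subseteq> ?S" unfolding S(1) by blast
    then show "y \<in> I" using *(1,3) initial_segment_downclosed unfolding I_def by blast
  qed
  \<comment> \<open>Two families of size \<open>k\<close> in a cube with \<open>2 ^ M\<close>
    vertices must overlap this much, which accounts for the excess term.\<close>
  moreover have "2 * k - 2 ^ M \<le> card (I \<inter> (\<lambda>x. ?T - x) ` I)"
  proof -
    let ?J = "(\<lambda>x. ?T - x) ` I"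
    have "card ?J = k" using cI card_image[OF inj_on_subset[OF inj_on_Diff IT]] by simp
    moreover have "card (I \<union> ?J) \<le> card (Pow ?T)" using IT by (intro card_mono) auto
    ultimately show ?thesis using card_Un_Int[of I ?J] finI cI by (simp add: card_Pow)
  qed
  ultimately have "4 * segment_edges k + 2 * (2 * k - 2 ^ M) \<le> inner_degree_sum ?S ?X"
    using split(3) by simp
  then have "inner_degree_sum ?S A \<le> inner_degree_sum ?S ?X" using upper by simp
  moreover have "card ?X = card A" using split(1) cI kA by simp
  moreover have "card (edge_boundary n ?X) + inner_degree_sum ?S ?X = n * card ?X"
    using XS unfolding S(1)[symmetric] by (rule card_edge_boundary)
  moreover note card_edge_boundary[OF assms(2)]
  ultimately show ?thesis unfolding I_def k_def by simp
qed

end
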